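(* For all integers $n>2$ and $r>0$, $$D_r(n)=r\,D_{r-1}(n-1)+(n-1)\,D_r(n-2)+(n+r-1)\,D_r(n-1).$$
   Context: For integers $n,r\ge 0$, the $r$-derangement number $D_r(n)$ is the number of permutations of $\{1,\dots,n+r\}$ that have no fixed points and in whose cycle decomposition the elements $1,\dots,r$ lie in pairwise distinct cycles. In particular $D_0(n)=D(n)$ is the classical derangement number, and $D_r(n)=0$ if $n<r$. *)

theory Defs
  imports "HOL-Combinatorics.Permutations" "HOL-Combinatorics.Orbits"
begin

(* For a permutation p of a finite set, orbit p x is the set of elements of the cycle of p
   through x, so two elements lie in the same cycle iff their orbits coincide. *)
definition r_derangements :: "nat \<Rightarrow> nat \<Rightarrow> (nat \<Rightarrow> nat) set" where
  "r_derangements r n =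
     {p. p permutes {1..n + r} \<and> (\<forall>i\<in>{1..n + r}. p i \<noteq> i) \<and>
         (\<forall>i\<in>{1..r}. \<forall>j\<in>{1..r}. i \<noteq> j \<longrightarrow> orbit p i \<noteq> orbit p j)}"

definition r_derangement_number :: "nat \<Rightarrow> nat \<Rightarrow> nat" where
  "r_derangement_number r n = card (r_derangements r n)"

end

theory Submission
  imports Defs
begin

text \<open>
  Remove the largest element \<open>N\<close> from its cycle in a derangement \<open>q\<close>, and let \<open>b = q N\<close>.
  Either the result is still a derangement (and \<open>b\<close> is one of the \<open>n + r - 1\<close> other elements), or
  \<open>N\<close> was in a 2-cycle with \<open>b\<close> and the result fixes exactly \<open>b\<close>, which is then dropped as well:
  this leaves one special element less if \<open>b\<close> is special, and one ordinary element less otherwise.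
  Doing this on arbitrary finite sets \<open>T \<subseteq> S\<close> instead of initial segments of the naturals
  makes relabelling unnecessary, since the resulting recurrence also shows that the count depends
  on the cardinalities only.
\<close>

section \<open>Derangements separating a set of special points\<close>

definition separates_orbits :: "'a set \<Rightarrow> ('a \<Rightarrow> 'a) \<Rightarrow> bool" where
  "separates_orbits T p \<longleftrightarrow> (\<forall>i\<in>T. \<forall>j\<in>T. i \<noteq> j \<longrightarrow> orbit p i \<noteq> orbit p j)"

definition separating_derangements :: "'a set \<Rightarrow> 'a set \<Rightarrow> ('a \<Rightarrow> 'a) set" where
  "separating_derangements T S =
     {p. p permutes S \<and> (\<forall>i\<in>S. p i \<noteq> i) \<and> separates_orbits T p}"

lemma finite_separating_derangements:
  "finite S \<Longrightarrow> finite (separating_derangements T S)"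
  unfolding separating_derangements_def
  by (rule finite_subset[OF _ finite_permutations]) auto

text \<open>Since \<open>orbit\<close> collects iterates with at least one step, \<open>x\<close>
  lies in its own orbit only because a permutation of a finite set returns to \<open>x\<close>; this
  makes orbit membership symmetric.\<close>

lemma orbit_eq_iff_permutes:
  assumes "p permutes S" "finite S"
  shows "orbit p x = orbit p y \<longleftrightarrow> y \<in> orbit p x"
proof -
  have self: "z \<in> orbit p z" for z
    using assms by (metis permutation_permutes permutation_self_in_orbit)
  show ?thesis
  proof
    show "orbit p x = orbit p y \<Longrightarrow> y \<in> orbit p x" using self by simp
  next
    assume y: "y \<in> orbit p x"
    then have "x \<in> orbit p y" using orbit_swap[OF self y] by simp
    with y show "orbit p x = orbit p y" by (blast intro: orbit_trans)
  qed
qed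

section \<open>Inserting a new element into a cycle\<close>

context
  fixes S :: "'a set" and N b :: 'a and p :: "'a \<Rightarrow> 'a"
  assumes fin: "finite S" and N: "N \<notin> S" and b: "b \<in> S" and p: "p permutes S"
begin

text \<open>As \<open>p\<close> fixes \<open>N\<close>, composing with \<open>transpose N b\<close>
  places \<open>N\<close> directly before \<open>b\<close> in the cycle of \<open>b\<close>. If
  \<open>p b = b\<close>, the result is the 2-cycle of \<open>N\<close> and
  \<open>b\<close>.\<close>

lemma insertion_apply:
  "(transpose N b \<circ> p) N = b"
  "x \<in> S \<Longrightarrow> p x = b \<Longrightarrow> (transpose N b \<circ> p) x = N"
  "x \<in> S \<Longrightarrow> p x \<noteq> b \<Longrightarrow> (transpose N b \<circ> p) x = p x"
proof -
  show "(transpose N b \<circ> p) N = b"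
    using N p by (simp add: permutes_not_in)
  show "x \<in> S \<Longrightarrow> p x = b \<Longrightarrow> (transpose N b \<circ> p) x = N"
    by simp
  assume "x \<in> S" "p x \<noteq> b"
  moreover from this have "p x \<noteq> N" using N p by (metis permutes_in_image)
  ultimately show "(transpose N b \<circ> p) x = p x" by simp
qed

lemma insertion_permutes: "(transpose N b \<circ> p) permutes insert N S"
  by (rule permutes_compose) (use p b in \<open>auto intro: permutes_subset permutes_swap_id\<close>)

lemma insertion_orbit_mem_iff:
  assumes x: "x \<in> S" and y: "y \<in> S"
  shows "y \<in> orbit (transpose N b \<circ> p) x \<longleftrightarrow> y \<in> orbit p x"
proof
  let ?q = "transpose N b \<circ> p"
  have in_S: "p z \<in> S" if "z \<in> S" for z
    using that p by (simp add: permutes_in_image)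
  \<comment> \<open>Contracting \<open>N\<close> to its successor \<open>b\<close> makes the claim inductive.\<close>
  have "z \<in> insert N S \<and> (if z = N then b else z) \<in> orbit p x" if "z \<in> orbit ?q x" for z
    using that
  proof induction
    case base
    then show ?case
      using x N in_S[OF x] orbit.base[of p x] insertion_apply(2,3)[OF x]
      by (cases "p x = b") auto
  next
    case (step z)
    show ?case
    proof (cases "z = N")
      case True
      then show ?thesis using step b N insertion_apply(1) by (auto split: if_splits)
    next
      case False
      then have z: "z \<in> S" "z \<in> orbit p x" using step by auto
      then have "p z \<in> orbit p x" by (intro orbit.step)
      then show ?thesis
        using N in_S[OF z(1)] insertion_apply(2,3)[OF z(1)] by (cases "p z = b") auto
    qed
  qed
  then show "y \<in> orbit p x" if "y \<in> orbit ?q x"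
    using that y N by metis
  \<comment> \<open>Conversely, each step of \<open>p\<close> inside \<open>S\<close> is one step of
    \<open>?q\<close>, or two steps passing through \<open>N\<close>.\<close>
  have "z \<in> S \<and> z \<in> orbit ?q x" if "z \<in> orbit p x" for z
    using that
  proof induction
    case base
    have "p x \<in> orbit ?q x"
      by (metis insertion_apply x orbit.base orbit.step)
    then show ?case using in_S x by blast
  next
    case (step z)
    then have "p z \<in> orbit ?q x"
      by (metis insertion_apply orbit.step)
    then show ?case using in_S step by blast
  qed
  then show "y \<in> orbit ?q x" if "y \<in> orbit p x"
    using that by blast
qed

lemma insertion_separates_orbits_iff:
  assumes "T \<subseteq> S"
  shows "separates_orbits T (transpose N b \<circ> p) \<longleftrightarrow> separates_orbits T p"
proof -
  have "orbit (transpose N b \<circ> p) i = orbit (transpose N b \<circ> p) j \<longleftrightarrow> orbit p i = orbit p j"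
    if "i \<in> T" "j \<in> T" for i j
    using that assms insertion_orbit_mem_iff
      orbit_eq_iff_permutes[OF insertion_permutes] orbit_eq_iff_permutes[OF p fin] fin
    by (metis finite_insert subsetD)
  then show ?thesis unfolding separates_orbits_def by blast
qed

text \<open>A fixed point is alone in its cycle, so its being special imposes no constraint.\<close>

lemma separates_orbits_fixed_point:
  assumes "p b = b"
  shows "separates_orbits (T - {b}) p \<longleftrightarrow> separates_orbits T p"
proof -
  have "orbit p b = {b}" using assms by (simp add: orbit_eq_singleton_iff)
  then have "orbit p i \<noteq> orbit p b" "orbit p b \<noteq> orbit p i" if "i \<noteq> b" for i
    using that orbit_eq_iff_permutes[OF p fin] by (metis singletonD)+
  then show ?thesis unfolding separates_orbits_def by (metis DiffE DiffI singletonD singletonI)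
qed

text \<open>Insertion removes a fixed point at \<open>b\<close> and creates none, so
  \<open>p\<close> may fix \<open>b\<close> but no other point of \<open>S\<close>. The two
  disjuncts are the cases where \<open>p\<close> moves \<open>b\<close> and where \<open>p\<close>
  fixes it, the latter meaning that \<open>p\<close> lives on \<open>S - {b}\<close>.\<close>

lemma insertion_mem_separating_derangements_iff:
  assumes "T \<subseteq> S"
  shows "transpose N b \<circ> p \<in> separating_derangements T (insert N S) \<longleftrightarrow>
     p \<in> separating_derangements T S \<or> p \<in> separating_derangements (T - {b}) (S - {b})"
proof -
  have "(transpose N b \<circ> p) x = x \<longleftrightarrow> p x = x \<and> x \<noteq> b" if "x \<in> S" for x
    using that N insertion_apply(2,3)[OF that] by (cases "p x = b") auto
  moreover have "(transpose N b \<circ> p) N \<noteq> N"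
    using insertion_apply(1) b N by metis
  ultimately have *: "transpose N b \<circ> p \<in> separating_derangements T (insert N S) \<longleftrightarrow>
      (\<forall>x\<in>S - {b}. p x \<noteq> x) \<and> separates_orbits T p"
    using insertion_permutes insertion_separates_orbits_iff[OF assms]
    unfolding separating_derangements_def by blast
  show ?thesis
  proof (cases "p b = b")
    case True
    then have "p permutes S - {b}"
      by (intro permutes_superset[OF p]) auto
    then show ?thesis
      unfolding * using True b separates_orbits_fixed_point[OF True]
      by (auto simp: separating_derangements_def)
  next
    case False
    then have "\<not> p permutes S - {b}"
      by (meson Diff_iff permutes_not_in singletonI)
    then show ?thesis
      unfolding * using False p by (auto simp: separating_derangements_def)
  qed
qed

end

section \<open>Counting by the image of the new element\<close>

lemma card_separating_derangements_insert:
  assumes fin: "finite S" and N: "N \<notin> S" and T: "T \<subseteq> S"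
  shows "card (separating_derangements T (insert N S)) =
     (\<Sum>b\<in>S. card (separating_derangements T S)
            + card (separating_derangements (T - {b}) (S - {b})))"
proof -
  let ?X = "separating_derangements T S"
  let ?Y = "\<lambda>b. separating_derangements (T - {b}) (S - {b})"
  let ?f = "\<lambda>(b, p). transpose N b \<circ> p"
  let ?g = "\<lambda>q. (q N, transpose N (q N) \<circ> q)"
  have perm: "p permutes S" if "p \<in> ?X \<union> ?Y b" for p b
    using that by (auto simp: separating_derangements_def intro: permutes_subset)
  \<comment> \<open>Insertion is undone by reading off \<open>b\<close> as the image of
    \<open>N\<close> and applying the same transposition again.\<close>
  have "bij_betw ?f (SIGMA b:S. ?X \<union> ?Y b) (separating_derangements T (insert N S))"
  proof (rule bij_betw_byWitness[where f' = ?g])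
    show "\<forall>a\<in>SIGMA b:S. ?X \<union> ?Y b. ?g (?f a) = a"
    proof
      fix a assume "a \<in> (SIGMA b:S. ?X \<union> ?Y b)"
      then obtain b p where a: "a = (b, p)" "b \<in> S" "p \<in> ?X \<union> ?Y b" by blast
      then have "(transpose N b \<circ> p) N = b"
        using perm insertion_apply(1)[OF fin N] by metis
      then show "?g (?f a) = a"
        by (simp add: a(1) fun_eq_iff)
    qed
    show "\<forall>q\<in>separating_derangements T (insert N S). ?f (?g q) = q"
      by (simp add: fun_eq_iff)
    show "?f ` (SIGMA b:S. ?X \<union> ?Y b) \<subseteq> separating_derangements T (insert N S)"
      using insertion_mem_separating_derangements_iff[OF fin N _ _ T] perm by fastforce
    show "?g ` separating_derangements T (insert N S) \<subseteq> (SIGMA b:S. ?X \<union> ?Y b)"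
    proof (rule image_subsetI)
      fix q assume q: "q \<in> separating_derangements T (insert N S)"
      let ?p = "transpose N (q N) \<circ> q"
      from q have perm_q: "q permutes insert N S" and "q N \<noteq> N"
        by (auto simp: separating_derangements_def)
      then have b: "q N \<in> S" by (metis insertE insertI1 permutes_in_image)
      \<comment> \<open>Thus \<open>q\<close> is itself an insertion into \<open>?p\<close>, which
        fixes \<open>N\<close> and permutes \<open>S\<close>, so the membership criterion can be
        read backwards.\<close>
      have "transpose N (q N) \<circ> ?p = q" by (simp add: fun_eq_iff)
      then show "?g q \<in> (SIGMA b:S. ?X \<union> ?Y b)"
        using q b insertion_mem_separating_derangements_iff[OF fin N b
            permutes_insert_lemma[OF perm_q] T]
        by simp
    qed
  qed
  then have "card (separating_derangements T (insert N S)) = card (SIGMA b:S. ?X \<union> ?Y b)"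
    by (simp add: bij_betw_same_card)
  also have "\<dots> = (\<Sum>b\<in>S. card (?X \<union> ?Y b))"
    using fin by (simp add: finite_separating_derangements)
  also have "\<dots> = (\<Sum>b\<in>S. card ?X + card (?Y b))"
  proof (rule sum.cong[OF refl])
    fix b assume "b \<in> S"
    \<comment> \<open>Elements of \<open>?X\<close> move \<open>b\<close>; those of
      \<open>?Y b\<close> fix it.\<close>
    then have "?X \<inter> ?Y b = {}"
      by (auto simp: separating_derangements_def dest: permutes_not_in)
    then show "card (?X \<union> ?Y b) = card ?X + card (?Y b)"
      using fin by (simp add: card_Un_disjoint finite_separating_derangements)
  qed
  finally show ?thesis .
qed

section \<open>Recursion in the two cardinalities\<close>

lemma separating_derangements_self:
  assumes "finite S"
  shows "separating_derangements S S = (if S = {} then {id} else {})"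
proof -
  \<comment> \<open>\<open>x\<close> and \<open>p x\<close> share a cycle; when every point is
    special, separation forces them to coincide.\<close>
  have "p x = x" if "p permutes S" "separates_orbits S p" "x \<in> S" for p x
    using that orbit_eq_iff_permutes[OF that(1) assms] orbit.base[of p x]
    unfolding separates_orbits_def by (metis permutes_in_image)
  then have "S = {}" if "p \<in> separating_derangements S S" for p
    using that unfolding separating_derangements_def by blast
  then show ?thesis
    by (auto simp: separating_derangements_def separates_orbits_def)
qed

text \<open>The arguments count special and ordinary elements. Where \<open>r - 1\<close> or
  \<open>n - 1\<close> truncates at 0, its factor \<open>r\<close> or \<open>n\<close>
  vanishes.\<close>

fun r_derangement_rec :: "nat \<Rightarrow> nat \<Rightarrow> nat" where
  "r_derangement_rec r 0 = (if r = 0 then 1 else 0)"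
| "r_derangement_rec r (Suc n) =
     r * r_derangement_rec (r - 1) n + n * r_derangement_rec r (n - 1)
     + (n + r) * r_derangement_rec r n"

lemma card_separating_derangements:
  assumes "finite S" "T \<subseteq> S"
  shows "card (separating_derangements T S) = r_derangement_rec (card T) (card (S - T))"
  using assms
proof (induction "card S" arbitrary: S T rule: less_induct)
  case less
  show ?case
  proof (cases "S = T")
    case True
    then show ?thesis using less.prems by (simp add: separating_derangements_self)
  next
    case False
    \<comment> \<open>The removed element is ordinary, so that all special elements remain in
      \<open>U\<close>.\<close>
    then obtain N where N: "N \<in> S" "N \<notin> T" using less.prems by blast
    define U where "U = S - {N}"
    have U: "S = insert N U" "N \<notin> U" "finite U" "T \<subseteq> U"
      using N less.prems by (auto simp: U_def)
    have finT: "finite T" using U finite_subset by blast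
    define n where "n = card (U - T)"
    have card_ST: "card (S - T) = Suc n"
      using U N by (simp add: n_def insert_Diff_if)
    have card_U: "card U = n + card T"
      using U finT by (simp add: n_def card_Diff_subset card_mono)
    have "card U < card S" using U by simp
    then have X: "card (separating_derangements T U) = r_derangement_rec (card T) n"
      using less.hyps U n_def by blast
    have Y: "card (separating_derangements (T - {b}) (U - {b})) =
        (if b \<in> T then r_derangement_rec (card T - 1) n
         else r_derangement_rec (card T) (n - 1))" if "b \<in> U" for b
    proof -
      have "card (U - {b}) < card S" using U that by (simp add: card_Diff1_le less_Suc_eq_le)
      then have "card (separating_derangements (T - {b}) (U - {b})) =
          r_derangement_rec (card (T - {b})) (card ((U - {b}) - (T - {b})))"
        using less.hyps U by (meson Diff_mono finite_Diff order_refl)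
      moreover have "(U - {b}) - (T - {b}) = (if b \<in> T then U - T else (U - T) - {b})"
        by auto
      ultimately show ?thesis using that finT U by (simp add: n_def)
    qed
    have "card (separating_derangements T S) =
        (\<Sum>b\<in>U. r_derangement_rec (card T) n
           + (if b \<in> T then r_derangement_rec (card T - 1) n
              else r_derangement_rec (card T) (n - 1)))"
      unfolding U(1) card_separating_derangements_insert[OF U(3,2,4)]
      using X Y by (intro sum.cong) auto
    also have "\<dots> = card U * r_derangement_rec (card T) n
        + (card T * r_derangement_rec (card T - 1) n + n * r_derangement_rec (card T) (n - 1))"
    proof -
      \<comment> \<open>The 2-cycle partner \<open>b\<close> of \<open>N\<close> is one of
        \<open>card T\<close> special or \<open>n\<close> ordinary elements, which gives the two
        coefficients.\<close>
      have "U \<inter> {b. b \<in> T} = T" "U \<inter> - {b. b \<in> T} = U - T" using U by auto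
      then show ?thesis using U by (simp add: sum.distrib sum.If_cases n_def)
    qed
    finally show ?thesis by (simp add: card_ST card_U)
  qed
qed

lemma r_derangement_number_eq_rec: "r_derangement_number r n = r_derangement_rec r n"
proof -
  have "r_derangements r n = separating_derangements {1..r} {1..n + r}"
    by (simp add: r_derangements_def separating_derangements_def separates_orbits_def)
  moreover have "card ({1..n + r} - {1..r}) = n"
    by (subst card_Diff_subset) auto
  ultimately show ?thesis
    by (simp add: r_derangement_number_def card_separating_derangements)
qed

theorem theorem2:
  fixes n r :: nat
  assumes "n > 2" and "r > 0"
  shows "r_derangement_number r n =
           r * r_derangement_number (r - 1) (n - 1)
           + (n - 1) * r_derangement_number r (n - 2)
           + (n + r - 1) * r_derangement_number r (n - 1)"
proof -
  \<comment> \<open>With \<open>m = n - 1\<close> the claim is the successor clause of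
    \<open>r_derangement_rec\<close>: \<open>m - 1\<close> is \<open>n - 2\<close> and
    \<open>m + r\<close> is \<open>n + r - 1\<close>.\<close>
  obtain m where "n = Suc m" using assms(1) by (cases n) auto
  then show ?thesis by (simp add: r_derangement_number_eq_rec)
qed

end
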